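(* Let $n\ge 1$ and for $m\ge1$ let $V_m$ denote the space of complex polynomials of degree less than $m$ in one variable $t$. Suppose that for each pair $1\le i<j\le n$ an ordered basis $({}^{ij}p_1,{}^{ij}p_2)$ of $V_2$ is given. An assignment of spinors $c$ is a choice, for each pair $i<j$, of one of ${}^{ij}p_1,{}^{ij}p_2$ to be $p^c_{ij}$, with $p^c_{ji}$ then defined to be the other element of the pair. For such $c$ put $p^c_i=\prod_{j\neq i}p^c_{ij}\in V_n$ for $1\le i\le n$. Then there exists an assignment of spinors $c$ such that $p^c_1,\ldots,p^c_n$ are linearly independent over $\mathbb{C}$. *)

theory Defs
  imports Complex_Main "HOL-Computational_Algebra.Polynomial"
begin

global_interpretation cpoly: vector_space "smult :: complex \<Rightarrow> complex poly \<Rightarrow> complex poly"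
  by unfold_locales (simp_all add: smult_add_right smult_add_left)

(* The space V_m is only meant for m >= 1: since degree 0 = 0, polys_below 0 is empty. *)
definition polys_below :: "nat \<Rightarrow> complex poly set" where
  "polys_below m = {p. degree p < m}"

definition ordered_basis_pair :: "complex poly set \<Rightarrow> complex poly \<times> complex poly \<Rightarrow> bool" where
  "ordered_basis_pair V b \<longleftrightarrow>
     fst b \<noteq> snd b \<and> cpoly.independent {fst b, snd b} \<and> cpoly.span {fst b, snd b} = V"

(* Independence of an indexed family; a repeated member makes the family dependent,
   which independence of the image set alone would not detect. *)
definition independent_family :: "'i set \<Rightarrow> ('i \<Rightarrow> complex poly) \<Rightarrow> bool" where
  "independent_family I p \<longleftrightarrow> inj_on p I \<and> cpoly.independent (p ` I)"

(* An assignment of spinors c is a choice for each pair i < j: c i j says that the first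
   element of the basis b i j becomes p_ij. Values b i j and c i j with i >= j are never used,
   and spinor b c i j is only meaningful for i \<noteq> j. *)
definition spinor ::
  "(nat \<Rightarrow> nat \<Rightarrow> complex poly \<times> complex poly) \<Rightarrow> (nat \<Rightarrow> nat \<Rightarrow> bool) \<Rightarrow> nat \<Rightarrow> nat \<Rightarrow> complex poly" where
  "spinor b c i j =
     (if i < j then (if c i j then fst (b i j) else snd (b i j))
      else (if c j i then snd (b j i) else fst (b j i)))"

definition spinor_prod ::
  "nat \<Rightarrow> (nat \<Rightarrow> nat \<Rightarrow> complex poly \<times> complex poly) \<Rightarrow> (nat \<Rightarrow> nat \<Rightarrow> bool) \<Rightarrow> nat \<Rightarrow> complex poly" where
  "spinor_prod n b c i = (\<Prod>j\<in>{1..n} - {i}. spinor b c i j)"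

end

theory Submission
  imports Defs "Jordan_Normal_Form.Determinant"
begin

text \<open>
  The determinant of the coefficients of the p_i is bilinear in (p_ij, p_ji) for every pair
  i < j, so its antisymmetrisation in that pair is the determinant of the basis b_ij times the
  antisymmetrisation at the basis (1, t). Doing this for all pairs, the alternating sum of the
  determinants over all assignments equals the product of the (nonzero) basis determinants times
  the same sum for the bases (1, t). In the latter p_i is t to the out-degree of i in a tournament,
  so only tournaments whose scores form a permutation contribute; these are the transitive ones,
  one for each permutation, and each contributes the sign of its permutation times (-1) to the
  number of inversions, that is 1. The sum is n!, so some summand is nonzero.
\<close>

hide_const (open) Module.smult

section \<open>Inversions and the sign of a permutation\<close>

definition pairs_below :: "nat \<Rightarrow> (nat \<times> nat) set" where
  "pairs_below n = {(i, j). i < j \<and> j < n}"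

lemma finite_pairs_below [simp]: "finite (pairs_below n)"
  by (rule finite_subset[of _ "{0..<n} \<times> {0..<n}"]) (auto simp: pairs_below_def)

definition inversions :: "nat \<Rightarrow> (nat \<Rightarrow> nat) \<Rightarrow> (nat \<times> nat) set" where
  "inversions n p = {(i, j) \<in> pairs_below n. p j < p i}"

lemma inversions_subset: "inversions n p \<subseteq> pairs_below n"
  by (auto simp: inversions_def)

text \<open>Comparing both orders, instead of testing for an inversion, gives a value to pairs
  listed either way round. This makes the sign multiplicative along compositions and, for injective
  \<open>p\<close>, symmetric in the pair.\<close>

definition order_sign :: "(nat \<Rightarrow> nat) \<Rightarrow> nat \<times> nat \<Rightarrow> int" where
  "order_sign p = (\<lambda>(i, j). if i < j \<longleftrightarrow> p i < p j then 1 else - 1)"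

lemma prod_order_sign:
  assumes "inj p"
  shows "prod (order_sign p) (pairs_below n) = (- 1) ^ card (inversions n p)"
proof -
  have "prod (order_sign p) (pairs_below n)
      = (\<Prod>e\<in>pairs_below n. if e \<in> inversions n p then - 1 else 1)"
  proof (rule prod.cong[OF refl])
    fix e assume "e \<in> pairs_below n"
    moreover obtain i j where "e = (i, j)" by force
    moreover have "p i < p j \<or> p j < p i" if "i \<noteq> j"
      using injD[OF assms, of i j] that by linarith
    ultimately show "order_sign p e = (if e \<in> inversions n p then - 1 else 1)"
      by (auto simp: order_sign_def inversions_def pairs_below_def)
  qed
  also have "\<dots> = (- 1) ^ card (inversions n p)"
    using inversions_subset[of n p]
    by (simp add: prod.If_cases Int_absorb1)
  finally show ?thesis .
qed

text \<open>Besides \<open>(a, b)\<close> itself, each index strictly between \<open>a\<close> and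
  \<open>b\<close> is inverted with \<open>a\<close> and with \<open>b\<close>, so the remaining
  inversions come in twos.\<close>

lemma odd_card_inversions_transpose:
  assumes "a < b" "b < n"
  shows "odd (card (inversions n (transpose a b)))"
proof -
  have "inversions n (transpose a b)
      = insert (a, b) ({a} \<times> {a<..<b} \<union> {a<..<b} \<times> {b})"
    using assms by (auto simp: inversions_def pairs_below_def transpose_def split: if_splits)
  moreover have "card ({a} \<times> {a<..<b} \<union> {a<..<b} \<times> {b}) = 2 * (b - a - 1)"
    by (subst card_Un_disjoint) (auto simp: card_cartesian_product)
  ultimately show ?thesis by simp
qed

lemma order_sign_comp:
  "order_sign (p \<circ> q) (i, j) = order_sign p (q i, q j) * order_sign q (i, j)"
  by (auto simp: order_sign_def)

lemma order_sign_sym: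
  assumes "inj p" "i \<noteq> j"
  shows "order_sign p (i, j) = order_sign p (j, i)"
proof -
  have "p i \<noteq> p j" using assms by (auto dest: injD)
  with assms(2) show ?thesis by (auto simp: order_sign_def)
qed

text \<open>The factor order_sign p at {t i, t j} does not depend on the order of the pair, so the product
  over all pairs can be reindexed along the transposition t.\<close>

lemma prod_order_sign_comp_transpose:
  assumes "inj p" "a < b" "b < n"
  shows "prod (order_sign (p \<circ> transpose a b)) (pairs_below n)
       = - prod (order_sign p) (pairs_below n)"
proof -
  define t where "t = transpose a b"
  have t_t: "t (t i) = i" for i by (simp add: t_def)
  then have inj_t: "inj t" by (metis injI)
  have t_lt: "t i < n" if "i < n" for i
    using that assms by (auto simp: t_def transpose_def)
  \<comment> \<open>\<open>m\<close> moves a pair along \<open>t\<close> and sorts it again; it is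
    an involution of \<open>pairs_below n\<close>, hence serves as its own inverse in the
    reindexing.\<close>
  define m where "m = (\<lambda>(i, j). (min (t i) (t j), max (t i) (t j)))"
  have "prod (order_sign (p \<circ> t)) (pairs_below n)
      = (\<Prod>(i, j)\<in>pairs_below n. order_sign p (t i, t j)) * prod (order_sign t) (pairs_below n)"
    unfolding prod.distrib[symmetric]
    by (intro prod.cong) (auto simp: order_sign_comp)
  also have "(\<Prod>(i, j)\<in>pairs_below n. order_sign p (t i, t j)) = prod (order_sign p) (pairs_below n)"
  proof (rule prod.reindex_bij_witness[of _ m m], goal_cases)
    case (5 e)
    obtain i j where e: "e = (i, j)" "i \<noteq> j" using 5 by (auto simp: pairs_below_def)
    then have "t i \<noteq> t j" using inj_t by (auto dest: injD)
    then show ?case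
      using order_sign_sym[OF assms(1), of "t i" "t j"] e by (auto simp: m_def min_def max_def)
  next
    case (1 e) then show ?case by (auto simp: m_def pairs_below_def min_def max_def t_t)
  next
    case (3 e) then show ?case by (auto simp: m_def pairs_below_def min_def max_def t_t)
  next
    case (2 e)
    then obtain i j where e: "e = (i, j)" "i < j" "j < n" by (auto simp: pairs_below_def)
    then have "t i \<noteq> t j" using inj_t by (auto dest: injD)
    then show ?case using e t_lt by (auto simp: m_def pairs_below_def min_def max_def)
  next
    case (4 e)
    then obtain i j where e: "e = (i, j)" "i < j" "j < n" by (auto simp: pairs_below_def)
    then have "t i \<noteq> t j" using inj_t by (auto dest: injD)
    then show ?case using e t_lt by (auto simp: m_def pairs_below_def min_def max_def)
  qed
  also have "prod (order_sign t) (pairs_below n) = - 1"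
    using odd_card_inversions_transpose[OF assms(2,3)]
    by (simp add: prod_order_sign[OF inj_t]) (simp add: t_def)
  finally show ?thesis by (simp only: t_def mult_minus1_right)
qed

text \<open>Both sides are 1 at the identity and change sign when a transposition is composed on the
  right, and such compositions generate all permutations.\<close>

lemma sign_eq_inversions:
  assumes "p permutes {0..<n}"
  shows "sign p = (- 1) ^ card (inversions n p)"
proof -
  have "sign p = prod (order_sign p) (pairs_below n)"
    using finite_atLeastLessThan assms
  proof (induction rule: permutes_rev_induct)
    case id
    show ?case by (simp add: order_sign_def case_prod_unfold)
  next
    case (swap a b p)
    have "inj p" using swap.hyps by (simp add: permutes_inj)
    then have "prod (order_sign (p \<circ> transpose a b)) (pairs_below n)
        = - prod (order_sign p) (pairs_below n)"
      using swap.hyps prod_order_sign_comp_transpose[of p a b n]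
        prod_order_sign_comp_transpose[of p b a n]
      by (cases a b rule: linorder_cases) (simp_all add: transpose_commute[of b a])
    moreover have "permutation p" using swap.hyps permutes_imp_permutation by blast
    then have "sign (p \<circ> transpose a b) = - sign p"
      using swap.hyps by (simp add: sign_compose permutation_swap_id sign_swap_id del: o_apply)
    ultimately show ?case by (simp only: swap.IH)
  qed
  with assms show ?thesis by (simp add: prod_order_sign permutes_inj)
qed

section \<open>Tournaments whose scores form a permutation\<close>

text \<open>A set A of pairs i < j encodes the tournament in which i beats j iff (i, j) lies in A.\<close>

definition out_neighbours :: "nat \<Rightarrow> (nat \<times> nat) set \<Rightarrow> nat \<Rightarrow> nat set" where
  "out_neighbours n A i = {j \<in> {0..<n} - {i}. if i < j then (i, j) \<in> A else (j, i) \<notin> A}"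

text \<open>\<open>p\<close> maps this set bijectively onto the numbers below
  \<open>p i\<close>.\<close>

lemma card_less_permutes:
  assumes "p permutes {0..<n}" "i < n"
  shows "card {j \<in> {0..<n}. p j < p i} = p i"
proof -
  have "p i < n" using permutes_in_image[OF assms(1), of i] assms(2) by simp
  have "p ` {j \<in> {0..<n}. p j < p i} = {0..<p i}"
  proof
    show "{0..<p i} \<subseteq> p ` {j \<in> {0..<n}. p j < p i}"
    proof
      fix k assume "k \<in> {0..<p i}"
      then have "k < p i" "k \<in> {0..<n}" using \<open>p i < n\<close> by auto
      moreover from this obtain j where "j \<in> {0..<n}" "k = p j"
        using permutes_image[OF assms(1)] by blast
      ultimately show "k \<in> p ` {j \<in> {0..<n}. p j < p i}" by blast
    qed
  qed auto
  moreover have "inj_on p {j \<in> {0..<n}. p j < p i}"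
    using permutes_inj[OF assms(1)] by (rule inj_on_subset) simp
  ultimately show ?thesis by (metis card_image card_atLeastLessThan diff_zero)
qed

text \<open>Such scores pin down the whole tournament: whoever has score \<open>n - 1\<close> beats
  everybody, whoever has \<open>n - 2\<close> beats everybody else, and so on.
  \<open>inversions n p\<close> encodes the tournament in which the larger value of \<open>p\<close>
  wins.\<close>

lemma scores_permutation_iff:
  assumes p: "p permutes {0..<n}" and A: "A \<subseteq> pairs_below n"
  shows "(\<forall>i<n. card (out_neighbours n A i) = p i) \<longleftrightarrow> A = inversions n p"
proof
  have p_eq: "p i = p j \<longleftrightarrow> i = j" for i j
    using permutes_inj[OF p] by (auto dest: injD)
  show "\<forall>i<n. card (out_neighbours n A i) = p i" if "A = inversions n p"
  proof (intro allI impI)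
    fix i assume "i < n"
    have "out_neighbours n A i = {j \<in> {0..<n}. p j < p i}"
      using \<open>i < n\<close> p_eq unfolding that out_neighbours_def inversions_def pairs_below_def
      by (auto simp: not_less split: if_splits) (metis le_neq_implies_less)+
    then show "card (out_neighbours n A i) = p i" using card_less_permutes[OF p \<open>i < n\<close>] by simp
  qed
  assume scores: "\<forall>i<n. card (out_neighbours n A i) = p i"
  \<comment> \<open>Downward induction on the score: i loses to everybody with a higher score, so it can
      reach its own score only by beating everybody with a lower one.\<close>
  have out: "out_neighbours n A i = {j \<in> {0..<n}. p j < p i}" if "i < n" for i
    using that
  proof (induction "n - p i" arbitrary: i rule: less_induct)
    case less
    have "out_neighbours n A i \<subseteq> {j \<in> {0..<n}. p j < p i}"
    proof
      fix j assume j: "j \<in> out_neighbours n A i"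
      then have "j < n" "j \<noteq> i" by (auto simp: out_neighbours_def)
      have "\<not> p i < p j"
      proof
        assume "p i < p j"
        moreover have "p j < n" using permutes_in_image[OF p, of j] \<open>j < n\<close> by simp
        ultimately have "i \<in> out_neighbours n A j"
          using less.hyps[of j] \<open>j < n\<close> less.prems by auto
        with j show False by (auto simp: out_neighbours_def split: if_splits)
      qed
      then show "j \<in> {j \<in> {0..<n}. p j < p i}"
        using p_eq[of i j] \<open>j < n\<close> \<open>j \<noteq> i\<close> by auto
    qed
    then show ?case
      using card_less_permutes[OF p less.prems] scores less.prems
      by (intro card_subset_eq) auto
  qed
  show "A = inversions n p"
  proof (rule Set.set_eqI)
    fix e :: "nat \<times> nat"
    obtain i j where e: "e = (i, j)" by force
    show "e \<in> A \<longleftrightarrow> e \<in> inversions n p"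
    proof (cases "e \<in> pairs_below n")
      case True
      then have "i < j" "j < n" by (auto simp: e pairs_below_def)
      then have "e \<in> A \<longleftrightarrow> j \<in> out_neighbours n A i" by (auto simp: e out_neighbours_def)
      also have "\<dots> \<longleftrightarrow> p j < p i" using out[of i] \<open>i < j\<close> \<open>j < n\<close> by auto
      finally show ?thesis using True by (simp add: e inversions_def)
    qed (use A in \<open>auto simp: inversions_def\<close>)
  qed
qed

section \<open>Alternating sums over all choices\<close>

lemma sum_Pow_insert:
  assumes "finite E" "e \<notin> E"
  shows "(\<Sum>A\<in>Pow (insert e E). g A) = (\<Sum>A\<in>Pow E. g A + g (insert e A))"
proof -
  have "inj_on (insert e) (Pow E)" using assms(2) by (auto simp: inj_on_def)
  moreover have "Pow E \<inter> insert e ` Pow E = {}" using assms(2) by auto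
  ultimately show ?thesis
    using assms(1) by (simp add: Pow_insert sum.union_disjoint sum.reindex sum.distrib)
qed

text \<open>\<open>A\<close> marks the coordinates that take the second value. Two sets differing
  only in \<open>e\<close> combine to a difference at \<open>e\<close>, which \<open>replace\<close>
  turns into \<open>w e\<close> times the standard one. As \<open>replace\<close> holds for every
  \<open>x\<close>, the coordinates can be exchanged one after another.\<close>

lemma alternating_sum_replace:
  fixes F :: "('e \<Rightarrow> 'v) \<Rightarrow> 'a :: comm_ring_1"
  assumes "finite E"
    and replace: "\<And>e x. e \<in> E \<Longrightarrow>
      F (x(e := b0 e)) - F (x(e := b1 e)) = w e * (F (x(e := s0 e)) - F (x(e := s1 e)))"
  shows "(\<Sum>A\<in>Pow E. (- 1) ^ card A * F (override_on (override_on d b0 E) b1 A))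
       = (\<Prod>e\<in>E. w e) *
         (\<Sum>A\<in>Pow E. (- 1) ^ card A * F (override_on (override_on d s0 E) s1 A))"
  using assms
proof (induction E arbitrary: d rule: finite_induct)
  case empty
  then show ?case by simp
next
  case (insert e E)
  \<comment> \<open>\<open>A\<close> and \<open>insert e A\<close> carry opposite signs, so they are
    summed together.\<close>
  have step: "(\<Sum>A\<in>Pow (insert e E). (- 1) ^ card A *
          F (override_on (override_on d c0 (insert e E)) c1 A))
      = (\<Sum>A\<in>Pow E. (- 1) ^ card A *
          (F ((override_on (override_on d c0 E) c1 A)(e := c0 e)) -
           F ((override_on (override_on d c0 E) c1 A)(e := c1 e))))" for c0 c1
    unfolding sum_Pow_insert[OF insert.hyps]
  proof (rule sum.cong[OF refl])
    fix A assume "A \<in> Pow E"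
    then have A: "e \<notin> A" "finite A" using insert.hyps finite_subset by auto
    have "override_on (override_on d c0 (insert e E)) c1 A
        = (override_on (override_on d c0 E) c1 A)(e := c0 e)"
      "override_on (override_on d c0 (insert e E)) c1 (insert e A)
        = (override_on (override_on d c0 E) c1 A)(e := c1 e)"
      using A by (auto simp: override_on_def)
    then show "(- 1) ^ card A * F (override_on (override_on d c0 (insert e E)) c1 A) +
        (- 1) ^ card (insert e A) * F (override_on (override_on d c0 (insert e E)) c1 (insert e A))
      = (- 1) ^ card A *
          (F ((override_on (override_on d c0 E) c1 A)(e := c0 e)) -
           F ((override_on (override_on d c0 E) c1 A)(e := c1 e)))"
      using A by (simp add: algebra_simps)
  qed
  \<comment> \<open>Since \<open>e\<close> lies outside \<open>E\<close>, its value can be absorbed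
    into the default function; this is why the induction keeps \<open>d\<close> arbitrary.\<close>
  have move: "(override_on (override_on d c0 E) c1 A)(e := v)
      = override_on (override_on (d(e := v)) c0 E) c1 A" if "A \<in> Pow E" for A c0 c1 v
    using that insert.hyps by (auto simp: override_on_def fun_eq_iff)
  have IH: "(\<Sum>A\<in>Pow E. (- 1) ^ card A * F ((override_on (override_on d b0 E) b1 A)(e := v)))
      = (\<Prod>e\<in>E. w e) *
        (\<Sum>A\<in>Pow E. (- 1) ^ card A * F ((override_on (override_on d s0 E) s1 A)(e := v)))" for v
  proof -
    have "(\<Sum>A\<in>Pow E. (- 1) ^ card A * F (override_on (override_on (d(e := v)) b0 E) b1 A))
      = (\<Prod>e\<in>E. w e) *
        (\<Sum>A\<in>Pow E. (- 1) ^ card A * F (override_on (override_on (d(e := v)) s0 E) s1 A))"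
      by (rule insert.IH) (use insert.prems in blast)
    then show ?thesis by (simp only: move cong: sum.cong)
  qed
  have "(\<Sum>A\<in>Pow (insert e E). (- 1) ^ card A *
          F (override_on (override_on d b0 (insert e E)) b1 A))
      = (\<Sum>A\<in>Pow E. w e * ((- 1) ^ card A *
          (F ((override_on (override_on d b0 E) b1 A)(e := s0 e)) -
           F ((override_on (override_on d b0 E) b1 A)(e := s1 e)))))"
    unfolding step insert.prems[of e, OF insertI1] by (simp add: mult_ac)
  also have "\<dots> = w e * (\<Prod>e\<in>E. w e) *
      (\<Sum>A\<in>Pow E. (- 1) ^ card A *
          (F ((override_on (override_on d s0 E) s1 A)(e := s0 e)) -
           F ((override_on (override_on d s0 E) s1 A)(e := s1 e))))"
    by (simp add: sum_distrib_left[symmetric] right_diff_distrib sum_subtractf IH mult.assoc)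
  finally show ?case
    unfolding step using insert.hyps by simp
qed

section \<open>Determinants of the coefficients of the products\<close>

text \<open>For \<open>i < j\<close> the single value \<open>x (i, j)\<close> holds both
  \<open>p_ij\<close> and \<open>p_ji\<close>, so changing the choice at one pair is one function
  update. Indices start at 0 to match matrices.\<close>

definition pair_prod ::
  "nat \<Rightarrow> (nat \<times> nat \<Rightarrow> 'a poly \<times> 'a poly) \<Rightarrow> nat \<Rightarrow> 'a :: comm_ring_1 poly" where
  "pair_prod n x i = (\<Prod>j\<in>{0..<n} - {i}. if i < j then fst (x (i, j)) else snd (x (j, i)))"

definition coeff_mat :: "nat \<Rightarrow> (nat \<Rightarrow> 'a poly) \<Rightarrow> 'a :: comm_ring_1 mat" where
  "coeff_mat n q = mat n n (\<lambda>(i, k). coeff (q i) k)"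

lemma det_coeff_mat:
  "det (coeff_mat n q)
     = (\<Sum>p | p permutes {0..<n}. of_int (sign p) * (\<Prod>i = 0..<n. coeff (q i) (p i)))"
  unfolding coeff_mat_def
  by (subst det_def'[of _ n])
    (auto intro!: sum.cong prod.cong simp: permutes_in_image sign_def)

text \<open>The source of bilinearity: \<open>u\<close> and \<open>v\<close> enter one product each,
  as a single factor.\<close>

lemma pair_prod_update:
  assumes "(k, l) \<in> pairs_below n"
  shows "pair_prod n (x((k, l) := (u, v))) k =
      u * (\<Prod>j\<in>{0..<n} - {k, l}. if k < j then fst (x (k, j)) else snd (x (j, k)))"
    and "pair_prod n (x((k, l) := (u, v))) l =
      v * (\<Prod>j\<in>{0..<n} - {k, l}. if l < j then fst (x (l, j)) else snd (x (j, l)))"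
    and "i \<noteq> k \<Longrightarrow> i \<noteq> l \<Longrightarrow> pair_prod n (x((k, l) := (u, v))) i = pair_prod n x i"
proof -
  have kl: "k < l" "l < n" using assms by (auto simp: pairs_below_def)
  have minus_k: "{0..<n} - {k} = insert l ({0..<n} - {k, l})" using kl by auto
  have "pair_prod n (x((k, l) := (u, v))) k = u * (\<Prod>j\<in>{0..<n} - {k, l}.
      if k < j then fst ((x((k, l) := (u, v))) (k, j)) else snd ((x((k, l) := (u, v))) (j, k)))"
    unfolding pair_prod_def minus_k using kl by (subst prod.insert) auto
  also have "\<dots> = u * (\<Prod>j\<in>{0..<n} - {k, l}. if k < j then fst (x (k, j)) else snd (x (j, k)))"
    using kl by (intro arg_cong[of _ _ "(*) u"] prod.cong refl) simp
  finally show "pair_prod n (x((k, l) := (u, v))) k =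
      u * (\<Prod>j\<in>{0..<n} - {k, l}. if k < j then fst (x (k, j)) else snd (x (j, k)))" .
  have minus_l: "{0..<n} - {l} = insert k ({0..<n} - {k, l})" using kl by auto
  have "pair_prod n (x((k, l) := (u, v))) l = v * (\<Prod>j\<in>{0..<n} - {k, l}.
      if l < j then fst ((x((k, l) := (u, v))) (l, j)) else snd ((x((k, l) := (u, v))) (j, l)))"
    unfolding pair_prod_def minus_l using kl by (subst prod.insert) auto
  also have "\<dots> = v * (\<Prod>j\<in>{0..<n} - {k, l}. if l < j then fst (x (l, j)) else snd (x (j, l)))"
    using kl by (intro arg_cong[of _ _ "(*) v"] prod.cong refl) simp
  finally show "pair_prod n (x((k, l) := (u, v))) l =
      v * (\<Prod>j\<in>{0..<n} - {k, l}. if l < j then fst (x (l, j)) else snd (x (j, l)))" .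
  show "i \<noteq> k \<Longrightarrow> i \<noteq> l \<Longrightarrow> pair_prod n (x((k, l) := (u, v))) i = pair_prod n x i"
    unfolding pair_prod_def by (intro prod.cong refl) simp
qed

text \<open>Expansion in the basis 1, \<open>[:0, 1:]\<close> that leaves the coefficients of
  \<open>r\<close> and \<open>[:0, 1:] * r\<close> as atoms, so that bilinearity becomes a ring
  identity.\<close>

lemma coeff_linear_mult:
  fixes r :: "'a :: comm_semiring_1 poly"
  shows   "coeff ([:a, b:] * r) m = a * coeff r m + b * coeff ([:0, 1:] * r) m"
  by (simp add: coeff_pCons split: nat.splits)

text \<open>An alternating bilinear form on a plane is determined by its value on one basis, up to
  the determinant of the change of basis. This is applied to each Leibniz term.\<close>

lemma det_pair_prod_antisym:
  assumes "(k, l) \<in> pairs_below n"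
  defines "F \<equiv> \<lambda>x. det (coeff_mat n (pair_prod n x))"
  shows "F (x((k, l) := ([:a, b:], [:c, d:]))) - F (x((k, l) := ([:c, d:], [:a, b:])))
    = (a * d - b * c) * (F (x((k, l) := (1, [:0, 1:]))) - F (x((k, l) := ([:0, 1:], 1))))"
proof -
  define T where "T = (\<lambda>u v p. \<Prod>i = 0..<n. coeff (pair_prod n (x((k, l) := (u, v))) i) (p i))"
  define rk where "rk = (\<Prod>j\<in>{0..<n} - {k, l}. if k < j then fst (x (k, j)) else snd (x (j, k)))"
  define rl where "rl = (\<Prod>j\<in>{0..<n} - {k, l}. if l < j then fst (x (l, j)) else snd (x (j, l)))"
  have kl: "k < l" "l < n" using assms by (auto simp: pairs_below_def)
  have T: "T u v p = coeff (u * rk) (p k) * coeff (v * rl) (p l) *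
      (\<Prod>i\<in>{0..<n} - {k, l}. coeff (pair_prod n x i) (p i))" for u v p
  proof -
    have "{0..<n} = insert k (insert l ({0..<n} - {k, l}))" using kl by auto
    then have "T u v p = (\<Prod>i\<in>insert k (insert l ({0..<n} - {k, l})).
        coeff (pair_prod n (x((k, l) := (u, v))) i) (p i))"
      by (simp add: T_def)
    also have "\<dots> = coeff (u * rk) (p k) * (coeff (v * rl) (p l) *
      (\<Prod>i\<in>{0..<n} - {k, l}. coeff (pair_prod n (x((k, l) := (u, v))) i) (p i)))"
      using kl by (simp add: pair_prod_update(1,2)[OF assms(1)] rk_def rl_def)
    also have "(\<Prod>i\<in>{0..<n} - {k, l}. coeff (pair_prod n (x((k, l) := (u, v))) i) (p i))
      = (\<Prod>i\<in>{0..<n} - {k, l}. coeff (pair_prod n x i) (p i))"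
      by (intro prod.cong) (auto simp: pair_prod_update(3)[OF assms(1)])
    finally show ?thesis by (simp add: mult.assoc)
  qed
  have F: "F (x((k, l) := (u, v))) = (\<Sum>p | p permutes {0..<n}. of_int (sign p) * T u v p)" for u v
    by (simp add: F_def det_coeff_mat T_def)
  \<comment> \<open>After expansion the terms with 1 twice or \<open>[:0, 1:]\<close> twice cancel;
    the mixed ones collect to \<open>a * d - b * c\<close>.\<close>
  have T_antisym: "T [:a, b:] [:c, d:] p - T [:c, d:] [:a, b:] p
      = (a * d - b * c) * (T 1 [:0, 1:] p - T [:0, 1:] 1 p)" for p
    unfolding T coeff_linear_mult[of a b] coeff_linear_mult[of c d] mult_1
    by (simp only: algebra_simps)
  show ?thesis
    unfolding F sum_subtractf[symmetric] sum_distrib_left right_diff_distrib[symmetric] T_antisym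
    by (simp add: mult_ac)
qed

text \<open>Each game gives its winner the factor \<open>[:0, 1:]\<close> and its loser the factor
  1.\<close>

lemma pair_prod_monomials:
  assumes "A \<subseteq> pairs_below n" "i < n"
  shows "pair_prod n (override_on (override_on d (\<lambda>_. (1, [:0, 1:])) (pairs_below n))
      (\<lambda>_. ([:0, 1:], 1)) A) i = monom 1 (card (out_neighbours n A i))"
proof -
  have "pair_prod n (override_on (override_on d (\<lambda>_. (1, [:0, 1:])) (pairs_below n))
      (\<lambda>_. ([:0, 1:], 1)) A) i
    = (\<Prod>j\<in>{0..<n} - {i}. if j \<in> out_neighbours n A i then monom 1 1 else 1)"
    unfolding pair_prod_def using assms
    by (intro prod.cong)
      (auto simp: override_on_def out_neighbours_def pairs_below_def monom_Suc one_pCons)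
  also have "\<dots> = (\<Prod>j\<in>out_neighbours n A i. monom 1 1)"
    by (simp add: prod.If_cases out_neighbours_def Int_def conj_commute conj_left_commute)
  finally show ?thesis by (simp add: monom_power)
qed

lemma alternating_sum_monomials:
  "(\<Sum>A\<in>Pow (pairs_below n). (- 1) ^ card A * det (coeff_mat n (pair_prod n
      (override_on (override_on d (\<lambda>_. (1, [:0, 1:])) (pairs_below n)) (\<lambda>_. ([:0, 1:], 1)) A))))
    = (of_nat (fact n) :: 'a :: comm_ring_1)"
proof -
  have "(\<Sum>A\<in>Pow (pairs_below n). (- 1) ^ card A * det (coeff_mat n (pair_prod n
      (override_on (override_on d (\<lambda>_. (1, [:0, 1:])) (pairs_below n)) (\<lambda>_. ([:0, 1:], 1)) A))))
    = (\<Sum>A\<in>Pow (pairs_below n). \<Sum>p | p permutes {0..<n}.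
        if A = inversions n p then (- 1) ^ card A * of_int (sign p) else (0 :: 'a))"
  proof (rule sum.cong[OF refl], unfold det_coeff_mat sum_distrib_left, rule sum.cong[OF refl])
    fix A and p :: "nat \<Rightarrow> nat"
    assume A: "A \<in> Pow (pairs_below n)" and p: "p \<in> {p. p permutes {0..<n}}"
    let ?x = "override_on (override_on d (\<lambda>_. (1, [:0, 1:])) (pairs_below n)) (\<lambda>_. ([:0, 1:], 1)) A"
    have "(\<Prod>i = 0..<n. coeff (pair_prod n ?x i) (p i))
        = (\<Prod>i = 0..<n. if card (out_neighbours n A i) = p i then 1 else (0 :: 'a))"
      using A by (intro prod.cong) (auto simp: pair_prod_monomials)
    also have "\<dots> = (if \<forall>i<n. card (out_neighbours n A i) = p i then 1 else 0)"
      by (auto intro!: prod.neutral prod_zero)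
    also have "\<dots> = (if A = inversions n p then 1 else 0)"
      using A p by (simp add: scores_permutation_iff)
    finally show "(- 1) ^ card A * (of_int (sign p) *
        (\<Prod>i = 0..<n. coeff (pair_prod n ?x i) (p i)))
      = (if A = inversions n p then (- 1) ^ card A * of_int (sign p) else 0)"
      by simp
  qed
  \<comment> \<open>With the sums exchanged, each \<open>p\<close> retains only the set
    \<open>inversions n p\<close>.\<close>
  also have "\<dots> = (\<Sum>p | p permutes {0..<n}. (- 1) ^ card (inversions n p) * of_int (sign p))"
    by (subst sum.swap) (simp add: inversions_subset cong: if_cong)
  \<comment> \<open>The sign of \<open>p\<close> is the same power of -1, so each summand is a
    square.\<close>
  also have "\<dots> = (\<Sum>p | p permutes {0..<n}. 1)"
    by (intro sum.cong) (auto simp: sign_eq_inversions simp flip: power_mult_distrib)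
  finally show ?thesis by (simp add: card_permutations)
qed

section \<open>Linear independence and bases\<close>

text \<open>A linear relation between the polynomials is one between the rows of the matrix, that
  is, a kernel vector of its transpose.\<close>

lemma independent_family_if_det_nonzero:
  assumes "det (coeff_mat n (\<lambda>i. q (f i))) \<noteq> 0" "bij_betw f {0..<n} I"
  shows "independent_family I q"
proof -
  have I: "I = f ` {0..<n}" "inj_on f {0..<n}" using assms(2) by (auto simp: bij_betw_def)
  have coeffs_zero: "c i = 0" if sum: "(\<Sum>i\<in>{0..<n}. smult (c i) (q (f i))) = 0" and "i < n" for c i
  proof (rule ccontr)
    assume "c i \<noteq> 0"
    let ?B = "transpose_mat (coeff_mat n (\<lambda>i. q (f i)))" and ?v = "vec n c"
    have carrier: "coeff_mat n (\<lambda>i. q (f i)) \<in> carrier_mat n n" by (simp add: coeff_mat_def)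
    have "?B *\<^sub>v ?v = 0\<^sub>v n"
    proof (rule eq_vecI)
      fix k assume "k < dim_vec (0\<^sub>v n)"
      then have k: "k < n" by simp
      then have "(?B *\<^sub>v ?v) $ k = (\<Sum>i\<in>{0..<n}. coeff (smult (c i) (q (f i))) k)"
        by (simp add: coeff_mat_def scalar_prod_def mult.commute)
      also have "\<dots> = 0" by (simp add: coeff_sum[symmetric] sum del: coeff_smult)
      finally show "(?B *\<^sub>v ?v) $ k = 0\<^sub>v n $ k" using k by simp
    qed (simp add: coeff_mat_def)
    moreover have "?v \<noteq> 0\<^sub>v n" using \<open>c i \<noteq> 0\<close> \<open>i < n\<close> by (metis index_vec index_zero_vec(1))
    ultimately have "det ?B = 0"
      using carrier by (subst det_0_iff_vec_prod_zero_field[of _ n]) (auto intro: exI[of _ ?v])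
    with assms(1) show False using det_transpose[OF carrier] by simp
  qed
  have inj: "inj_on (\<lambda>i. q (f i)) {0..<n}"
  proof (rule inj_onI, rule ccontr)
    fix i j assume ij: "i \<in> {0..<n}" "j \<in> {0..<n}" "q (f i) = q (f j)" "i \<noteq> j"
    \<comment> \<open>A repeated member would give the relation with coefficients 1 and -1.\<close>
    define c where "c = (\<lambda>k. if k = i then 1 else if k = j then - 1 else (0 :: complex))"
    have "(\<Sum>k\<in>{0..<n}. smult (c k) (q (f k)))
        = (\<Sum>k\<in>{i, j}. smult (c k) (q (f k)))"
      using ij by (intro sum.mono_neutral_right) (auto simp: c_def)
    also have "\<dots> = 0" using ij by (simp add: c_def)
    finally show False using coeffs_zero[of c i] ij by (simp add: c_def)
  qed
  have "cpoly.independent (q ` I)"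
  proof (rule ccontr)
    assume "\<not> cpoly.independent (q ` I)"
    then obtain u v where uv: "v \<in> q ` I" "u v \<noteq> 0" "(\<Sum>v\<in>q ` I. smult (u v) v) = 0"
      using I by (subst (asm) cpoly.dependent_finite) auto
    have qI: "q ` I = (\<lambda>i. q (f i)) ` {0..<n}" by (simp add: I image_image)
    have "(\<Sum>i\<in>{0..<n}. smult (u (q (f i))) (q (f i))) = 0"
      using uv(3) unfolding qI by (simp add: sum.reindex[OF inj])
    then show False using coeffs_zero[of "\<lambda>i. u (q (f i))"] uv(1,2) unfolding qI by auto
  qed
  moreover have "inj_on q I" unfolding I(1) using inj by (auto simp: inj_on_def)
  ultimately show ?thesis by (simp add: independent_family_def)
qed

lemma linear_poly_eq:
  assumes "degree p < 2"
  shows "p = [:coeff p 0, coeff p 1:]"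
proof (rule poly_eqI)
  fix m :: nat
  consider "m = 0" | "m = 1" | "m \<ge> 2" by linarith
  then show "coeff p m = coeff [:coeff p 0, coeff p 1:] m"
    using assms by cases (auto simp: coeff_pCons coeff_eq_0 split: nat.splits)
qed

lemma ordered_basis_pair_polys_below_2:
  assumes "ordered_basis_pair (polys_below 2) (u, v)"
  obtains a b c d where "u = [:a, b:]" "v = [:c, d:]" "a * d - b * c \<noteq> 0"
proof -
  have uv: "u \<noteq> v" "cpoly.independent {u, v}" "degree u < 2" "degree v < 2"
    using assms cpoly.span_superset[of "{u, v}"]
    by (auto simp: ordered_basis_pair_def polys_below_def)
  obtain a b c d where eq: "u = [:a, b:]" "v = [:c, d:]"
    using linear_poly_eq uv(3,4) by meson
  have zero: "s = 0 \<and> t = 0" if "smult s u + smult t v = 0" for s t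
  proof -
    let ?w = "\<lambda>p. if p = u then s else t"
    have "(\<Sum>p\<in>{u, v}. smult (?w p) p) = 0" using that uv(1) by simp
    then have "?w p = 0" if "p \<in> {u, v}" for p
      using cpoly.independentD[OF uv(2), of "{u, v}" ?w p] that by auto
    from this[of u] this[of v] show ?thesis using uv(1) by simp
  qed
  have "a * d - b * c \<noteq> 0"
  proof
    assume "a * d - b * c = 0"
    \<comment> \<open>With a vanishing determinant these relations hold, and independence forces all
      four coefficients to be 0.\<close>
    then have "smult c u + smult (- a) v = 0" "smult d u + smult (- b) v = 0"
      by (simp_all add: eq mult_ac)
    from zero[OF this(1)] zero[OF this(2)] have "u = 0" by (simp add: eq)
    then show False using zero[of 1 0] by simp
  qed
  with eq that show ?thesis by blast
qed

section \<open>Existence of the assignment\<close>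

theorem theorem4:
  fixes n :: nat
    and b :: "nat \<Rightarrow> nat \<Rightarrow> complex poly \<times> complex poly"
  assumes "n \<ge> 1"
    and "\<And>i j. 1 \<le> i \<Longrightarrow> i < j \<Longrightarrow> j \<le> n \<Longrightarrow> ordered_basis_pair (polys_below 2) (b i j)"
  shows "\<exists>c. independent_family {1..n} (spinor_prod n b c)"
proof -
  \<comment> \<open>The shift from indices 1 to \<open>n\<close> to indices below \<open>n\<close>;
    \<open>b1\<close> is the opposite choice at each pair.\<close>
  define b0 where "b0 = (\<lambda>(i, j). b (Suc i) (Suc j))"
  define b1 where "b1 = (\<lambda>e. prod.swap (b0 e))"
  define w where "w = (\<lambda>e. coeff (fst (b0 e)) 0 * coeff (snd (b0 e)) 1
    - coeff (fst (b0 e)) 1 * coeff (snd (b0 e)) 0)"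
  define x where "x = (\<lambda>A. override_on (override_on (\<lambda>_. (0, 0)) b0 (pairs_below n)) b1 A)"
  let ?F = "\<lambda>x. det (coeff_mat n (pair_prod n x))"
  have basis: "\<exists>p q r s. b0 e = ([:p, q:], [:r, s:]) \<and> p * s - q * r \<noteq> 0"
    if "e \<in> pairs_below n" for e
  proof -
    obtain i j where e: "e = (i, j)" "i < j" "j < n"
      using \<open>e \<in> pairs_below n\<close> unfolding pairs_below_def by blast
    have "ordered_basis_pair (polys_below 2) (fst (b0 e), snd (b0 e))"
      using assms(2)[of "Suc i" "Suc j"] e by (simp add: b0_def)
    then show ?thesis by (metis ordered_basis_pair_polys_below_2 prod.collapse)
  qed
  have "(\<Sum>A\<in>Pow (pairs_below n). (- 1) ^ card A * ?F (x A)) = prod w (pairs_below n) *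
      (\<Sum>A\<in>Pow (pairs_below n). (- 1) ^ card A * ?F (override_on
        (override_on (\<lambda>_. (0, 0)) (\<lambda>_. (1, [:0, 1:])) (pairs_below n)) (\<lambda>_. ([:0, 1:], 1)) A))"
    unfolding x_def
  proof (rule alternating_sum_replace)
    fix e y assume e: "e \<in> pairs_below n"
    obtain k l where kl: "e = (k, l)" by force
    obtain p q r s where "b0 e = ([:p, q:], [:r, s:])" using basis[OF e] by blast
    then show "?F (y(e := b0 e)) - ?F (y(e := b1 e))
        = w e * (?F (y(e := (1, [:0, 1:]))) - ?F (y(e := ([:0, 1:], 1))))"
      using det_pair_prod_antisym[of k l n y p q r s] e by (simp add: b1_def w_def kl)
  qed simp
  also have "\<dots> = prod w (pairs_below n) * of_nat (fact n)"
    by (simp only: alternating_sum_monomials)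
  \<comment> \<open>Each \<open>w e\<close> is a basis determinant, and \<open>fact n\<close> is
    nonzero in characteristic 0.\<close>
  also have "\<dots> \<noteq> 0" using basis by (fastforce simp: w_def)
  finally obtain A where A: "A \<subseteq> pairs_below n" "?F (x A) \<noteq> 0"
    by (metis (no_types, lifting) PowD mult_zero_right sum.neutral)
  \<comment> \<open>\<open>A\<close> marks the swapped pairs, where \<open>p_ij\<close> is the
    second basis element, so \<open>c\<close> is its complement, with the index shift
    undone.\<close>
  define c where "c = (\<lambda>i j. (i - 1, j - 1) \<notin> A)"
  have "spinor_prod n b c (Suc i) = pair_prod n (x A) i" if "i < n" for i
  proof -
    have "{1..n} - {Suc i} = Suc ` ({0..<n} - {i})"
      by (simp add: image_set_diff image_Suc_atLeastLessThan atLeastLessThanSuc_atLeastAtMost)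
    then have "spinor_prod n b c (Suc i) = (\<Prod>j\<in>{0..<n} - {i}. spinor b c (Suc i) (Suc j))"
      by (simp add: spinor_prod_def prod.reindex)
    also have "\<dots> = pair_prod n (x A) i"
      unfolding pair_prod_def using that A(1)
      by (intro prod.cong)
        (auto simp: spinor_def c_def x_def override_on_def b0_def b1_def pairs_below_def)
    finally show ?thesis .
  qed
  then have "coeff_mat n (\<lambda>i. spinor_prod n b c (Suc i)) = coeff_mat n (pair_prod n (x A))"
    by (auto simp: coeff_mat_def intro!: eq_matI)
  moreover have "bij_betw Suc {0..<n} {1..n}"
    by (auto simp: bij_betw_def image_Suc_atLeastLessThan atLeastLessThanSuc_atLeastAtMost)
  ultimately show ?thesis
    using independent_family_if_det_nonzero[of n "spinor_prod n b c" Suc] A(2) by metis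
qed

end
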